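(* Let $(\theta_i)_{i\ge 1}$ and $(\kappa_{i,j})_{i,j\ge 1}$ be sequences of non-negative real numbers such that the coagulation kernel satisfies $\Lambda_{i,j}=\theta_i\theta_j+\kappa_{i,j}$ for all $i,j\ge 1$. Assume that $$\Lambda_{i,j}\ge C(ij)^{\frac{\kappa_0}{2}},\qquad i,j\ge 1,$$ for some $\kappa_0\in(1,2)$ and $C>0$. Let $\omega^{in}\in Y_1^+$, $\omega^{in}\not\equiv0$, and let $\omega=(\omega_i)_{i\ge1}$ be a solution on $[0,+\infty)$ to the discrete Safronov-Dubovskii coagulation equations with initial datum $\omega^{in}$. Then $T_{\text{gel}}<+\infty$.
   Context: The coagulation kernel $(\Lambda_{i,j})_{i,j\ge1}$ is non-negative and symmetric: $0\le\Lambda_{i,j}=\Lambda_{j,i}$ for all $i,j\ge 1$. The discrete Safronov-Dubovskii coagulation equations with initial datum $\omega^{in}=(\omega_i^{in})_{i\ge1}$, $\omega_i^{in}\ge0$, are, for $i\ge 1$, $$\frac{d\omega_i(t)}{dt}=\omega_{i-1}(t)\sum_{j=1}^{i-1}j\Lambda_{i-1,j}\omega_j(t)-\omega_i(t)\sum_{j=1}^{i}j\Lambda_{i,j}\omega_j(t)-\sum_{j=i}^{\infty}\Lambda_{i,j}\omega_i(t)\omega_j(t),\qquad \omega_i(0)=\omega_i^{in},$$ where the first term on the right-hand side is $0$ when $i=1$. Solution: for $T\in(0,+\infty]$, a solution on $[0,T)$ is a sequence $\omega=(\omega_i)_{i\ge1}$ of non-negative continuous functions on $[0,T)$ such that, for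 each $i\ge1$ and $t\in(0,T)$: $\omega_i\in\mathcal{C}([0,T))$, $\sum_{j=1}^\infty\Lambda_{i,j}\omega_j\in L^1(0,t)$, and $$\omega_i(t)=\omega_i^{in}+\int_0^t\Big(\omega_{i-1}(s)\sum_{j=1}^{i-1}j\Lambda_{i-1,j}\omega_j(s)-\omega_i(s)\sum_{j=1}^{i}j\Lambda_{i,j}\omega_j(s)-\sum_{j=i}^{\infty}\Lambda_{i,j}\omega_i(s)\omega_j(s)\Big)ds .$$ $Y_1^+$ is the set of sequences $y=(y_i)_{i\ge1}$ of non-negative real numbers with $\|y\|_1:=\sum_{i=1}^\infty i\,y_i<\infty$. The gelation time $T_{\text{gel}}\in[0,+\infty]$ of a solution $\omega$ with initial datum $\omega^{in}$ is $$T_{\text{gel}}=\inf\Big\{t\ge0:\ \sum_{i=1}^\infty i\,\omega_i(t)<\sum_{i=1}^\infty i\,\omega_i^{in}\Big\}.$$ *)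

theory Defs
  imports "HOL-Analysis.Analysis"
begin

text \<open>
  Sequences indexed by the integers \<open>i \<ge> 1\<close> are functions on \<^typ>\<open>nat\<close> whose value at index
  \<open>0\<close> is irrelevant.
\<close>

definition coagulation_kernel :: "(nat \<Rightarrow> nat \<Rightarrow> real) \<Rightarrow> bool" where
  "coagulation_kernel \<Lambda> \<longleftrightarrow> (\<forall>i\<ge>1. \<forall>j\<ge>1. 0 \<le> \<Lambda> i j \<and> \<Lambda> i j = \<Lambda> j i)"

text \<open>
  For \<open>i = 1\<close> the first sum below ranges over the empty set, so the gain term vanishes and
  \<open>\<omega> 0\<close> plays no role.
\<close>

definition sd_rhs :: "(nat \<Rightarrow> nat \<Rightarrow> real) \<Rightarrow> (nat \<Rightarrow> real \<Rightarrow> real) \<Rightarrow> nat \<Rightarrow> real \<Rightarrow> real" where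
  "sd_rhs \<Lambda> \<omega> i s =
     \<omega> (i - 1) s * (\<Sum>j = 1..i - 1. real j * \<Lambda> (i - 1) j * \<omega> j s)
     - \<omega> i s * (\<Sum>j = 1..i. real j * \<Lambda> i j * \<omega> j s)
     - (\<Sum>\<^sub>\<infinity>j\<in>{i..}. \<Lambda> i j * \<omega> i s * \<omega> j s)"

text \<open>
  The sum \<open>\<Sum>j\<ge>1. \<Lambda> i j * \<omega> j s\<close> of non-negative terms takes values in \<open>[0, \<infinity>]\<close>.  That it belongs
  to \<open>L\<^sup>1(0, t)\<close> is expressed by almost everywhere convergence together with integrability of its
  real value; the convergence has to be stated because \<^const>\<open>infsum\<close> is \<open>0\<close> where the sum
  diverges.  As \<open>\<omega> i\<close> is bounded on \<open>[0, t]\<close>, this makes \<^const>\<open>sd_rhs\<close> integrable there, so the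
  integral in the last clause is never a default value.
\<close>

definition sd_solution ::
    "(nat \<Rightarrow> nat \<Rightarrow> real) \<Rightarrow> (nat \<Rightarrow> real) \<Rightarrow> ennreal \<Rightarrow> (nat \<Rightarrow> real \<Rightarrow> real) \<Rightarrow> bool" where
  "sd_solution \<Lambda> \<omega>in T \<omega> \<longleftrightarrow> 0 < T \<and>
     (\<forall>i\<ge>1.
        (\<forall>t\<ge>0. ennreal t < T \<longrightarrow> 0 \<le> \<omega> i t) \<and>
        continuous_on {t. 0 \<le> t \<and> ennreal t < T} (\<omega> i) \<and>
        (\<forall>t>0. ennreal t < T \<longrightarrow>
           (AE s in lborel. s \<in> {0<..<t} \<longrightarrow> (\<lambda>j. \<Lambda> i j * \<omega> j s) summable_on {1..}) \<and>
           set_integrable lborel {0<..<t} (\<lambda>s. \<Sum>\<^sub>\<infinity>j\<in>{1..}. \<Lambda> i j * \<omega> j s) \<and>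
           \<omega> i t = \<omega>in i + (LINT s:{0..t}|lborel. sd_rhs \<Lambda> \<omega> i s)))"

definition Y1_plus :: "(nat \<Rightarrow> real) set" where
  "Y1_plus = {y. (\<forall>i\<ge>1. 0 \<le> y i) \<and> (\<lambda>i. real i * y i) summable_on {1..}}"

text \<open>
  The first moment is taken in \<open>[0, \<infinity>]\<close>, because its finiteness at positive times is not part of
  the notion of solution.
\<close>

definition first_moment :: "(nat \<Rightarrow> real) \<Rightarrow> ennreal" where
  "first_moment y = (\<Sum>\<^sub>\<infinity>i\<in>{1..}. ennreal (real i * y i))"

text \<open>
  The infimum is taken in \<open>[0, \<infinity>]\<close>, so it is \<open>\<infinity>\<close> for the empty set.  All times \<open>t \<ge> 0\<close> are
  considered, so this is meaningful for solutions on \<open>[0, \<infinity>)\<close>.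
\<close>

definition gelation_time :: "(nat \<Rightarrow> real) \<Rightarrow> (nat \<Rightarrow> real \<Rightarrow> real) \<Rightarrow> ennreal" where
  "gelation_time \<omega>in \<omega> =
     (INF t\<in>{t. 0 \<le> t \<and> first_moment (\<lambda>i. \<omega> i t) < first_moment \<omega>in}. ennreal t)"

end

theory Submission
  imports Defs
begin

text \<open>
  Write \<open>F A s = (\<Sum>i\<ge>A. i powr (\<kappa>\<^sub>0 / 2) * \<omega> i s)\<close>.  Testing the equations against the sequence
  \<open>min i A\<close> leaves no contribution of the sizes below \<open>A\<close>: there the sequence is \<open>i\<close>, and mass is
  formally conserved.  What remains is a loss of at least \<open>A * \<Lambda> i j * \<omega> i * \<omega> j\<close> for each pair
  \<open>A \<le> i \<le> j\<close>, hence, by the lower bound on the kernel, of at least \<open>A * C / 2 * (F A)\<^sup>2\<close>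
  (lemma \<open>sum_min_sd_rhs_le_square\<close>).  Since \<open>\<Sum>i. min i A * \<omega> i\<close> is non-negative and initially at
  most the initial mass \<open>M\<close>, integration in time yields \<open>\<integral> (F A)\<^sup>2 \<le> 2 * M / (A * C)\<close>, uniformly in the
  length of the time interval (lemma \<open>integral_tail_square_le\<close>).

  The tails control the mass: as \<open>i powr (1 - \<kappa>\<^sub>0 / 2) \<le> (\<Sum>A\<le>i. A powr (- \<kappa>\<^sub>0 / 2))\<close>, the first moment
  is at most \<open>\<Sum>A. A powr (- \<kappa>\<^sub>0 / 2) * F A\<close>.  The \<open>L\<^sup>2\<close> norm in time of the term with index \<open>A\<close> is
  of order \<open>A powr (- (\<kappa>\<^sub>0 + 1) / 2)\<close>, and these bounds are summable precisely because \<open>\<kappa>\<^sub>0 > 1\<close>.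
  Thus the square of the first moment has a bounded integral over all time intervals \<open>{0..t}\<close>
  (lemma \<open>integral_truncated_moment_square_le\<close>).  A first moment that never fell below \<open>M > 0\<close> would
  make this integral grow at least like \<open>t * M\<^sup>2\<close>, so mass must be lost in finite time.

  Nothing is known a priori about convergence of the moments at positive times.  All sums over sizes
  are therefore cut off at a finite \<open>m\<close>; the cutoff creates a flux out of the size \<open>m\<close>, which is a
  further loss and can be dropped.  Only the last step lets \<open>m\<close> tend to infinity, by monotone
  convergence.
\<close>

section \<open>Finite sums and the moment inequality\<close>

text \<open>
  Summation by parts: the increments of \<open>\<lambda>i. min i A\<close> are \<open>1\<close> below \<open>A\<close> and \<open>0\<close> from there on.
\<close>

lemma sum_min_telescope:
  fixes g :: "nat \<Rightarrow> real"
  assumes "g 0 = 0"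
  shows "(\<Sum>i = 1..m. real (min i A) * (g (i - 1) - g i)) + real (min m A) * g m
    = (\<Sum>i = 1..<m. if i < A then g i else 0)"
proof (induction m)
  case (Suc m)
  have "real (min (Suc m) A) * g m - real (min m A) * g m = (if m < A then g m else 0)"
    by (simp add: min_def algebra_simps)
  with Suc assms show ?case
    by (cases "m = 0") (simp_all add: algebra_simps)
qed (simp add: assms)

lemma sum_triangle_swap:
  fixes f :: "nat \<Rightarrow> nat \<Rightarrow> real"
  shows "(\<Sum>i = 1..m. \<Sum>j = i..m. f i j) = (\<Sum>j = 1..m. \<Sum>i = 1..j. f i j)"
proof (induction m)
  case (Suc m)
  have "(\<Sum>i = 1..m. \<Sum>j = i..Suc m. f i j) = (\<Sum>i = 1..m. (\<Sum>j = i..m. f i j) + f i (Suc m))"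
    by (intro sum.cong) auto
  with Suc show ?case
    by (simp add: sum.distrib)
qed simp

lemma square_sum_le_twice_triangle:
  fixes a :: "nat \<Rightarrow> real"
  shows "(\<Sum>i = A..m. a i)\<^sup>2 \<le> 2 * (\<Sum>j = A..m. \<Sum>i = A..j. a i * a j)"
proof (induction m)
  case 0
  then show ?case by (cases "A = 0") (auto simp: power2_eq_square)
next
  case (Suc m)
  show ?case
  proof (cases "A \<le> Suc m")
    case True
    have "(\<Sum>i = A..Suc m. a i)\<^sup>2 = (\<Sum>i = A..m. a i)\<^sup>2 + 2 * (\<Sum>i = A..m. a i) * a (Suc m) + (a (Suc m))\<^sup>2"
      using True by (simp add: power2_eq_square algebra_simps)
    also have "\<dots> \<le> 2 * (\<Sum>j = A..m. \<Sum>i = A..j. a i * a j) + 2 * (\<Sum>i = A..Suc m. a i * a (Suc m))"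
      proof -
      have new_row: "(\<Sum>i = A..Suc m. a i * a (Suc m)) = (\<Sum>i = A..m. a i) * a (Suc m) + (a (Suc m))\<^sup>2"
        using True by (simp add: sum_distrib_right power2_eq_square)
      show ?thesis
        using Suc zero_le_power2[of "a (Suc m)"]
        unfolding new_row ring_distribs mult.assoc by linarith
    qed
    finally show ?thesis using True by (simp add: algebra_simps)
  qed simp
qed

text \<open>Each of the \<open>i\<close> terms on the right is at least \<open>i powr (- p)\<close>.\<close>

lemma powr_le_sum_powr:
  fixes p :: real
  assumes "0 \<le> p"
  shows "real i powr (1 - p) \<le> (\<Sum>A = 1..i. real A powr (- p))"
proof (cases "i = 0")
  case False
  have "real i powr (1 - p) = (\<Sum>A = 1..i. real i powr (- p))"
    using False by (simp add: powr_diff powr_minus divide_simps)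
  also have "\<dots> \<le> (\<Sum>A = 1..i. real A powr (- p))"
    using assms by (intro sum_mono powr_mono2') auto
  finally show ?thesis .
qed simp

text \<open>
  The first moment is at most \<open>\<Sum>A. A powr (- k / 2) * F A\<close> with the tails
  \<open>F A = (\<Sum>i = A..m. i powr (k / 2) * y i)\<close>, by an exchange of sums.  The weights in the
  Cauchy-Schwarz inequality are chosen for the estimate \<open>\<integral> (F A)\<^sup>2 = O(1 / A)\<close> satisfied by solutions:
  with it, both factors are governed by the same sum \<open>\<Sum>A. A powr (- (k + 1) / 2)\<close>.
\<close>

lemma first_moment_square_le_tail_squares:
  fixes y :: "nat \<Rightarrow> real" and k :: real
  assumes y: "\<And>i. 1 \<le> i \<Longrightarrow> 0 \<le> y i" and k: "0 \<le> k"
  shows "(\<Sum>i = 1..m. real i * y i)\<^sup>2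
    \<le> (\<Sum>A = 1..m. real A powr (- ((k + 1) / 2)))
      * (\<Sum>A = 1..m. real A powr ((1 - k) / 2) * (\<Sum>i = A..m. real i powr (k / 2) * y i)\<^sup>2)"
proof -
  define F where "F A = (\<Sum>i = A..m. real i powr (k / 2) * y i)" for A
  have F0: "0 \<le> F A" if "1 \<le> A" for A
    unfolding F_def using that y by (intro sum_nonneg) auto
  have "(\<Sum>i = 1..m. real i * y i) \<le> (\<Sum>i = 1..m. \<Sum>A = 1..i. real A powr (- (k / 2)) * (real i powr (k / 2) * y i))"
  proof (rule sum_mono)
    fix i assume i: "i \<in> {1..m}"
    have "real i * y i = real i powr (1 - k / 2) * (real i powr (k / 2) * y i)"
      using i by (simp flip: powr_add mult.assoc)
    also have "\<dots> \<le> (\<Sum>A = 1..i. real A powr (- (k / 2))) * (real i powr (k / 2) * y i)"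
      using i y k by (intro mult_right_mono powr_le_sum_powr) auto
    finally show "real i * y i \<le> (\<Sum>A = 1..i. real A powr (- (k / 2)) * (real i powr (k / 2) * y i))"
      by (simp add: sum_distrib_right)
  qed
  also have "\<dots> = (\<Sum>A = 1..m. real A powr (- (k / 2)) * F A)"
    unfolding F_def sum_distrib_left by (rule sum_triangle_swap[symmetric])
  also have "\<dots> = (\<Sum>A = 1..m. real A powr (- ((k + 1) / 4)) * (real A powr ((1 - k) / 4) * F A))"
  proof -
    have "- (k / 2) = - ((k + 1) / 4) + (1 - k) / 4"
      by (simp add: field_simps)
    then have "real A powr (- (k / 2)) = real A powr (- ((k + 1) / 4)) * real A powr ((1 - k) / 4)" for A
      by (metis powr_add)
    then show ?thesis by (simp only: mult.assoc)
  qed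
  finally have *: "(\<Sum>i = 1..m. real i * y i) \<le> \<dots>" .
  have "(\<Sum>i = 1..m. real i * y i)\<^sup>2
      \<le> (\<Sum>A = 1..m. real A powr (- ((k + 1) / 4)) * (real A powr ((1 - k) / 4) * F A))\<^sup>2"
    using * y by (intro power_mono sum_nonneg) auto
  also have "\<dots> \<le> (\<Sum>A = 1..m. (real A powr (- ((k + 1) / 4)))\<^sup>2) * (\<Sum>A = 1..m. (real A powr ((1 - k) / 4) * F A)\<^sup>2)"
    by (rule Cauchy_Schwarz_ineq_sum)
  also have "\<dots> = (\<Sum>A = 1..m. real A powr (- ((k + 1) / 2))) * (\<Sum>A = 1..m. real A powr ((1 - k) / 2) * (F A)\<^sup>2)"
  proof -
    have "(real A powr x)\<^sup>2 = real A powr (2 * x)" for A x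
      by (simp add: power2_eq_square flip: powr_add)
    moreover have "2 * - ((k + 1) / 4) = - ((k + 1) / 2)" "2 * ((1 - k) / 4) = (1 - k) / 2"
      by (simp_all add: field_simps)
    ultimately show ?thesis by (simp only: power_mult_distrib)
  qed
  finally show ?thesis unfolding F_def .
qed

section \<open>Dissipation of the truncated mass\<close>

text \<open>
  Let \<open>g i\<close> be the flux from size \<open>i\<close> to size \<open>i + 1\<close>.  Summation by parts turns gain and loss by
  growth into \<open>\<Sum>j<A. g j\<close>, up to the flux out of size \<open>m\<close>, which only decreases the left-hand side.
  By symmetry of the kernel the remaining loss, summed over pairs \<open>i \<le> j\<close>, is exactly \<open>g j\<close> for each
  \<open>j < A\<close>, where \<open>min i A = i\<close>.  The sizes below \<open>A\<close> thus cancel; for \<open>j \<ge> A\<close> the loss has no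
  counterpart, and keeping the pairs with \<open>i \<ge> A\<close> gives the bound.
\<close>

lemma sum_min_sd_rhs_le:
  assumes K: "coagulation_kernel \<Lambda>"
    and w: "\<And>i. 1 \<le> i \<Longrightarrow> 0 \<le> \<omega> i s"
    and S: "\<And>i. 1 \<le> i \<Longrightarrow> (\<lambda>j. \<Lambda> i j * \<omega> j s) summable_on {1..}"
    and A: "1 \<le> A"
  shows "(\<Sum>i = 1..m. real (min i A) * sd_rhs \<Lambda> \<omega> i s)
    \<le> - (real A * (\<Sum>j = A..m. \<Sum>i = A..j. \<Lambda> i j * \<omega> i s * \<omega> j s))"
proof -
  have L0: "0 \<le> \<Lambda> i j" and Lsym: "\<Lambda> i j = \<Lambda> j i" if "1 \<le> i" "1 \<le> j" for i j
    using K that unfolding coagulation_kernel_def by auto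
  define h where "h i j = \<Lambda> i j * \<omega> i s * \<omega> j s" for i j
  have h0: "0 \<le> h i j" if "1 \<le> i" "1 \<le> j" for i j
    using that w L0 by (simp add: h_def)
  define g where "g i = \<omega> i s * (\<Sum>j = 1..i. real j * \<Lambda> i j * \<omega> j s)" for i
  have g0: "0 \<le> g i" for i
    by (cases "i = 0") (auto simp: g_def intro!: mult_nonneg_nonneg sum_nonneg w L0)
  have g_eq: "g j = (\<Sum>i = 1..j. real i * h i j)" if "1 \<le> j" for j
    unfolding g_def h_def sum_distrib_left using that by (intro sum.cong) (auto simp: Lsym)
  have rhs: "sd_rhs \<Lambda> \<omega> i s \<le> (g (i - 1) - g i) - (\<Sum>j = i..m. h i j)" if i: "1 \<le> i" for i
  proof -
    have "(\<lambda>j. \<omega> i s * (\<Lambda> i j * \<omega> j s)) summable_on {i..}"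
      using i by (intro summable_on_cmult_right summable_on_subset_banach[OF S[OF i]]) auto
    then have "(\<lambda>j. h i j) summable_on {i..}"
      by (simp add: h_def mult_ac)
    then have "(\<Sum>j = i..m. h i j) \<le> (\<Sum>\<^sub>\<infinity>j\<in>{i..}. h i j)"
      using i by (intro finite_sum_le_infsum) (auto intro: h0)
    then show ?thesis
      unfolding sd_rhs_def g_def h_def by simp
  qed
  have "(\<Sum>i = 1..m. real (min i A) * sd_rhs \<Lambda> \<omega> i s)
      \<le> (\<Sum>i = 1..m. real (min i A) * ((g (i - 1) - g i) - (\<Sum>j = i..m. h i j)))"
    by (intro sum_mono mult_left_mono rhs) auto
  also have "\<dots> = (\<Sum>i = 1..m. real (min i A) * (g (i - 1) - g i)) - (\<Sum>i = 1..m. \<Sum>j = i..m. real (min i A) * h i j)"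
    by (simp add: right_diff_distrib sum_subtractf sum_distrib_left)
  also have "\<dots> \<le> (\<Sum>j = 1..m. if j < A then g j else 0) - (\<Sum>j = 1..m. \<Sum>i = 1..j. real (min i A) * h i j)"
  proof -
    have "0 \<le> real (min m A) * g m"
      using g0 by simp
    then have "(\<Sum>i = 1..m. real (min i A) * (g (i - 1) - g i)) \<le> (\<Sum>i = 1..<m. if i < A then g i else 0)"
      using sum_min_telescope[of g A m] by (simp add: g_def)
    also have "\<dots> \<le> (\<Sum>i = 1..m. if i < A then g i else 0)"
      using g0 by (intro sum_mono2) auto
    finally show ?thesis unfolding sum_triangle_swap by simp
  qed
  also have "\<dots> = (\<Sum>j = 1..m. (if j < A then g j else 0) - (\<Sum>i = 1..j. real (min i A) * h i j))"
    by (simp add: sum_subtractf)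
  also have "\<dots> \<le> (\<Sum>j = 1..m. if j < A then 0 else - (\<Sum>i = A..j. real A * h i j))"
  proof (rule sum_mono)
    fix j assume j: "j \<in> {1..m}"
    show "(if j < A then g j else 0) - (\<Sum>i = 1..j. real (min i A) * h i j)
      \<le> (if j < A then 0 else - (\<Sum>i = A..j. real A * h i j))"
    proof (cases "j < A")
      case True
      then have "(\<Sum>i = 1..j. real (min i A) * h i j) = g j"
        using j by (subst g_eq) (auto intro!: sum.cong simp: min_def)
      with True show ?thesis by simp
    next
      case False
      have "(\<Sum>i = A..j. real A * h i j) = (\<Sum>i = A..j. real (min i A) * h i j)"
        by (intro sum.cong) auto
      also have "\<dots> \<le> (\<Sum>i = 1..j. real (min i A) * h i j)"
        using A j h0 by (intro sum_mono2) auto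
      finally show ?thesis using False by simp
    qed
  qed
  also have "\<dots> = (\<Sum>j = A..m. - (\<Sum>i = A..j. real A * h i j))"
    using A by (intro sum.mono_neutral_cong_right) auto
  also have "\<dots> = - (real A * (\<Sum>j = A..m. \<Sum>i = A..j. h i j))"
    by (simp add: sum_negf sum_distrib_left)
  finally show ?thesis unfolding h_def .
qed

lemma sum_min_sd_rhs_le_square:
  assumes K: "coagulation_kernel \<Lambda>"
    and low: "\<And>i j. 1 \<le> i \<Longrightarrow> 1 \<le> j \<Longrightarrow> C * (real i * real j) powr (k / 2) \<le> \<Lambda> i j"
    and C: "0 \<le> C"
    and w: "\<And>i. 1 \<le> i \<Longrightarrow> 0 \<le> \<omega> i s"
    and S: "\<And>i. 1 \<le> i \<Longrightarrow> (\<lambda>j. \<Lambda> i j * \<omega> j s) summable_on {1..}"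
    and A: "1 \<le> A"
  shows "(\<Sum>i = 1..m. real (min i A) * sd_rhs \<Lambda> \<omega> i s)
    \<le> - (real A * C / 2 * (\<Sum>i = A..m. real i powr (k / 2) * \<omega> i s)\<^sup>2)"
proof -
  let ?a = "\<lambda>i. real i powr (k / 2) * \<omega> i s"
  have "C * (\<Sum>i = A..m. ?a i)\<^sup>2 \<le> C * (2 * (\<Sum>j = A..m. \<Sum>i = A..j. ?a i * ?a j))"
    using C by (intro mult_left_mono square_sum_le_twice_triangle)
  also have "\<dots> = 2 * (\<Sum>j = A..m. \<Sum>i = A..j. C * (real i * real j) powr (k / 2) * \<omega> i s * \<omega> j s)"
    by (simp add: sum_distrib_left powr_mult mult_ac)
  also have "\<dots> \<le> 2 * (\<Sum>j = A..m. \<Sum>i = A..j. \<Lambda> i j * \<omega> i s * \<omega> j s)"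
    using A w by (intro mult_left_mono sum_mono mult_right_mono low) auto
  finally have "real A * (C * (\<Sum>i = A..m. ?a i)\<^sup>2)
      \<le> real A * (2 * (\<Sum>j = A..m. \<Sum>i = A..j. \<Lambda> i j * \<omega> i s * \<omega> j s))"
    by (intro mult_left_mono) auto
  with sum_min_sd_rhs_le[where m = m and \<omega> = \<omega> and s = s, OF K w S A] show ?thesis
    by simp
qed

section \<open>Integrability of the right-hand side\<close>

text \<open>
  The identity holds for divergent sums as well: then \<open>infsum\<close> has its default value \<open>0\<close>, which is
  also the value of \<open>enn2real\<close> at \<open>\<infinity>\<close>.  It reduces measurability of sums to the case of values in
  \<open>[0, \<infinity>]\<close>, where divergence needs no exceptional set.
\<close>

lemma infsum_eq_enn2real_suminf:
  fixes f :: "nat \<Rightarrow> real"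
  assumes "\<And>j. j \<in> A \<Longrightarrow> 0 \<le> f j"
  shows "infsum f A = enn2real (\<Sum>j. ennreal (if j \<in> A then f j else 0))"
proof -
  let ?g = "\<lambda>j. if j \<in> A then f j else 0"
  have g0: "0 \<le> ?g j" for j using assms by simp
  have eq: "infsum f A = infsum ?g UNIV"
    by (rule infsum_cong_neutral) auto
  show ?thesis
  proof (cases "summable ?g")
    case True
    then have "?g summable_on UNIV"
      using g0 by (simp only: summable_on_UNIV_nonneg_real_iff)
    then have "infsum ?g UNIV = suminf ?g"
      using has_sum_imp_sums sums_unique by (metis (no_types, lifting) has_sum_infsum)
    with True eq g0 show ?thesis
      by (simp only: suminf_ennreal2) (simp add: suminf_nonneg)
  next
    case False
    then have "\<not> ?g summable_on UNIV"
      using summable_on_imp_summable by blast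
    moreover have "(\<Sum>j. ennreal (?g j)) = top"
      using False by (rule contrapos_np) (rule summable_suminf_not_top[OF g0])
    ultimately show ?thesis using eq by (simp add: infsum_not_exists)
  qed
qed

lemma borel_measurable_infsum_nat:
  fixes f :: "nat \<Rightarrow> 'a \<Rightarrow> real"
  assumes "\<And>j. j \<in> A \<Longrightarrow> f j \<in> borel_measurable M" and "\<And>j x. j \<in> A \<Longrightarrow> 0 \<le> f j x"
  shows "(\<lambda>x. \<Sum>\<^sub>\<infinity>j\<in>A. f j x) \<in> borel_measurable M"
proof -
  have [measurable]: "(\<lambda>x. if j \<in> A then f j x else 0) \<in> borel_measurable M" for j
    using assms by (cases "j \<in> A") auto
  show ?thesis
    using assms(2) by (subst infsum_eq_enn2real_suminf) measurable
qed

lemma set_integral_sum: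
  fixes f :: "'i \<Rightarrow> 'a \<Rightarrow> real"
  assumes "\<And>i. i \<in> I \<Longrightarrow> set_integrable M A (f i)"
  shows "set_integrable M A (\<lambda>x. \<Sum>i\<in>I. f i x)"
    and "(LINT x:A|M. \<Sum>i\<in>I. f i x) = (\<Sum>i\<in>I. LINT x:A|M. f i x)"
  using assms unfolding set_integrable_def set_lebesgue_integral_def scaleR_sum_right
  by (auto intro!: Bochner_Integration.integrable_sum Bochner_Integration.integral_sum)

text \<open>
  The finite sums are continuous in time.  The infinite one is at most a bound for \<open>\<omega> i\<close> on \<open>{0..t}\<close>
  times \<open>\<Sum>j. \<Lambda> i j * \<omega> j\<close>, almost everywhere.
\<close>

lemma sd_rhs_integrable:
  assumes K: "coagulation_kernel \<Lambda>"
    and w: "\<And>i s. 1 \<le> i \<Longrightarrow> s \<in> {0..t} \<Longrightarrow> 0 \<le> \<omega> i s"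
    and c: "\<And>i. 1 \<le> i \<Longrightarrow> continuous_on {0..t} (\<omega> i)"
    and S: "AE s\<in>{0..t} in lborel. (\<lambda>j. \<Lambda> i j * \<omega> j s) summable_on {1..}"
    and I: "set_integrable lborel {0..t} (\<lambda>s. \<Sum>\<^sub>\<infinity>j\<in>{1..}. \<Lambda> i j * \<omega> j s)"
    and i: "1 \<le> i"
  shows "set_integrable lborel {0..t} (sd_rhs \<Lambda> \<omega> i)"
proof -
  have L0: "0 \<le> \<Lambda> i j" if "1 \<le> j" for j
    using K that i unfolding coagulation_kernel_def by auto
  have gain: "continuous_on {0..t} (\<lambda>s. \<omega> (i - 1) s * (\<Sum>j = 1..i - 1. real j * \<Lambda> (i - 1) j * \<omega> j s))"
    by (cases "i = 1") (use i in \<open>auto intro!: continuous_intros c\<close>)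
  have loss: "continuous_on {0..t} (\<lambda>s. \<omega> i s * (\<Sum>j = 1..i. real j * \<Lambda> i j * \<omega> j s))"
    using i by (auto intro!: continuous_intros c)
  obtain B where B: "\<And>s. s \<in> {0..t} \<Longrightarrow> \<omega> i s \<le> B"
  proof -
    have "bounded (\<omega> i ` {0..t})"
      using c[OF i] by (intro compact_imp_bounded compact_continuous_image) auto
    then obtain B where "\<forall>x\<in>\<omega> i ` {0..t}. norm x \<le> B"
      unfolding bounded_iff by blast
    then show ?thesis
      by (intro that[of B]) force
  qed
  have tail: "set_integrable lborel {0..t} (\<lambda>s. \<Sum>\<^sub>\<infinity>j\<in>{i..}. \<Lambda> i j * \<omega> i s * \<omega> j s)"
  proof (rule set_integrable_bound)
    show "set_integrable lborel {0..t} (\<lambda>s. B * (\<Sum>\<^sub>\<infinity>j\<in>{1..}. \<Lambda> i j * \<omega> j s))"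
      using I by simp
    \<comment> \<open>The indicator goes inside the sum, because the terms are non-negative on \<open>{0..t}\<close> only.\<close>
    have "(\<lambda>s. \<Sum>\<^sub>\<infinity>j\<in>{i..}. indicator {0..t} s *\<^sub>R (\<Lambda> i j * \<omega> i s * \<omega> j s)) \<in> borel_measurable lborel"
    proof (rule borel_measurable_infsum_nat)
      fix j assume j: "j \<in> {i..}"
      show "(\<lambda>s. indicator {0..t} s *\<^sub>R (\<Lambda> i j * \<omega> i s * \<omega> j s)) \<in> borel_measurable lborel"
        unfolding measurable_lborel2
        by (intro borel_measurable_continuous_on_indicator continuous_intros c) (use i j in auto)
      show "0 \<le> indicator {0..t} s *\<^sub>R (\<Lambda> i j * \<omega> i s * \<omega> j s)" for s
        using i j w L0 by (auto simp: indicator_def)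
    qed
    moreover have "(\<lambda>s. \<Sum>\<^sub>\<infinity>j\<in>{i..}. indicator {0..t} s *\<^sub>R (\<Lambda> i j * \<omega> i s * \<omega> j s))
        = (\<lambda>s. indicator {0..t} s *\<^sub>R (\<Sum>\<^sub>\<infinity>j\<in>{i..}. \<Lambda> i j * \<omega> i s * \<omega> j s))"
      by (auto simp: indicator_def fun_eq_iff)
    ultimately show "set_borel_measurable lborel {0..t} (\<lambda>s. \<Sum>\<^sub>\<infinity>j\<in>{i..}. \<Lambda> i j * \<omega> i s * \<omega> j s)"
      unfolding set_borel_measurable_def by simp
    show "AE s in lborel. s \<in> {0..t} \<longrightarrow> norm (\<Sum>\<^sub>\<infinity>j\<in>{i..}. \<Lambda> i j * \<omega> i s * \<omega> j s)
        \<le> norm (B * (\<Sum>\<^sub>\<infinity>j\<in>{1..}. \<Lambda> i j * \<omega> j s))"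
      using S
    proof eventually_elim
      case (elim s)
      show ?case
      proof
        assume s: "s \<in> {0..t}"
        have sm: "(\<lambda>j. \<Lambda> i j * \<omega> j s) summable_on {1..}" using elim s by simp
        have nn: "0 \<le> \<Lambda> i j * \<omega> j s" if "1 \<le> j" for j
          using that s w L0 by simp
        have "(\<Sum>\<^sub>\<infinity>j\<in>{i..}. \<Lambda> i j * \<omega> i s * \<omega> j s) = \<omega> i s * (\<Sum>\<^sub>\<infinity>j\<in>{i..}. \<Lambda> i j * \<omega> j s)"
          by (simp add: mult_ac flip: infsum_cmult_right')
        moreover have "(\<Sum>\<^sub>\<infinity>j\<in>{i..}. \<Lambda> i j * \<omega> j s) \<le> (\<Sum>\<^sub>\<infinity>j\<in>{1..}. \<Lambda> i j * \<omega> j s)"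
          using i nn by (intro infsum_mono2 sm summable_on_subset_banach[OF sm]) auto
        moreover have "0 \<le> (\<Sum>\<^sub>\<infinity>j\<in>{i..}. \<Lambda> i j * \<omega> j s)"
          using i nn by (intro infsum_nonneg) auto
        moreover have "0 \<le> \<omega> i s" "\<omega> i s \<le> B" using s w i B by auto
        ultimately show "norm (\<Sum>\<^sub>\<infinity>j\<in>{i..}. \<Lambda> i j * \<omega> i s * \<omega> j s)
            \<le> norm (B * (\<Sum>\<^sub>\<infinity>j\<in>{1..}. \<Lambda> i j * \<omega> j s))"
          by (auto simp: abs_mult intro!: mult_mono)
      qed
    qed
  qed
  show ?thesis
    unfolding sd_rhs_def
    by (intro set_integral_diff(1) borel_integrable_atLeastAtMost' gain loss tail)
qed

section \<open>Integrated estimates for a solution\<close>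

text \<open>
  The estimates below use the closed interval \<open>{0..t}\<close> and one null set common to all sizes.
\<close>

lemma sd_solution_global:
  assumes sol: "sd_solution \<Lambda> \<omega>in \<infinity> \<omega>" and t: "0 < t"
  shows "\<And>i s. 1 \<le> i \<Longrightarrow> s \<in> {0..t} \<Longrightarrow> 0 \<le> \<omega> i s"
    and "\<And>i. 1 \<le> i \<Longrightarrow> continuous_on {0..t} (\<omega> i)"
    and "AE s\<in>{0..t} in lborel. \<forall>i\<ge>1. (\<lambda>j. \<Lambda> i j * \<omega> j s) summable_on {1..}"
    and "\<And>i. 1 \<le> i \<Longrightarrow> set_integrable lborel {0..t} (\<lambda>s. \<Sum>\<^sub>\<infinity>j\<in>{1..}. \<Lambda> i j * \<omega> j s)"
    and "\<And>i. 1 \<le> i \<Longrightarrow> \<omega> i t = \<omega>in i + (LINT s:{0..t}|lborel. sd_rhs \<Lambda> \<omega> i s)"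
proof -
  have sol': "(\<forall>s\<ge>0. 0 \<le> \<omega> i s) \<and> continuous_on {s. 0 \<le> s} (\<omega> i) \<and>
      (AE s in lborel. s \<in> {0<..<t} \<longrightarrow> (\<lambda>j. \<Lambda> i j * \<omega> j s) summable_on {1..}) \<and>
      set_integrable lborel {0<..<t} (\<lambda>s. \<Sum>\<^sub>\<infinity>j\<in>{1..}. \<Lambda> i j * \<omega> j s) \<and>
      \<omega> i t = \<omega>in i + (LINT s:{0..t}|lborel. sd_rhs \<Lambda> \<omega> i s)" if "1 \<le> i" for i
    using sol t that unfolding sd_solution_def by simp
  show "\<And>i s. 1 \<le> i \<Longrightarrow> s \<in> {0..t} \<Longrightarrow> 0 \<le> \<omega> i s"
    using sol' by auto
  show "\<And>i. 1 \<le> i \<Longrightarrow> continuous_on {0..t} (\<omega> i)"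
    by (rule continuous_on_subset[of "{s. 0 \<le> s}"]) (use sol' in auto)
  show "\<And>i. 1 \<le> i \<Longrightarrow> \<omega> i t = \<omega>in i + (LINT s:{0..t}|lborel. sd_rhs \<Lambda> \<omega> i s)"
    using sol' by auto
  have "AE s in lborel. \<forall>i. 1 \<le> i \<longrightarrow> s \<in> {0<..<t} \<longrightarrow> (\<lambda>j. \<Lambda> i j * \<omega> j s) summable_on {1..}"
    unfolding AE_all_countable using sol' by auto
  moreover have "AE s in lborel. s \<noteq> 0" "AE s in lborel. s \<noteq> t"
    by (rule AE_lborel_singleton)+
  ultimately show "AE s\<in>{0..t} in lborel. \<forall>i\<ge>1. (\<lambda>j. \<Lambda> i j * \<omega> j s) summable_on {1..}"
    by eventually_elim auto
  have "set_integrable lborel {0} f" "set_integrable lborel {t} f" for f :: "real \<Rightarrow> real"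
    using borel_integrable_atLeastAtMost'[of 0 0 f] borel_integrable_atLeastAtMost'[of t t f] by auto
  moreover have "{0..t} = {0} \<union> ({0<..<t} \<union> {t})"
    using t by auto
  ultimately show "\<And>i. 1 \<le> i \<Longrightarrow> set_integrable lborel {0..t} (\<lambda>s. \<Sum>\<^sub>\<infinity>j\<in>{1..}. \<Lambda> i j * \<omega> j s)"
    using sol' by (simp only:, intro set_integrable_Un) auto
qed

text \<open>
  Integrated in time, the dissipation of \<open>\<Sum>i. min i A * \<omega> i\<close> cannot exceed its initial value, because
  this sum stays non-negative.
\<close>

lemma integral_tail_square_le:
  assumes K: "coagulation_kernel \<Lambda>"
    and low: "\<And>i j. 1 \<le> i \<Longrightarrow> 1 \<le> j \<Longrightarrow> C * (real i * real j) powr (k / 2) \<le> \<Lambda> i j"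
    and C: "0 \<le> C"
    and sol: "sd_solution \<Lambda> \<omega>in \<infinity> \<omega>"
    and t: "0 < t" and A: "1 \<le> A"
  shows "real A * C / 2 * (LINT s:{0..t}|lborel. (\<Sum>i = A..m. real i powr (k / 2) * \<omega> i s)\<^sup>2)
    \<le> (\<Sum>i = 1..m. real (min i A) * \<omega>in i)"
proof -
  note w = sd_solution_global(1)[OF sol t] and c = sd_solution_global(2)[OF sol t]
    and S = sd_solution_global(3)[OF sol t] and I = sd_solution_global(4)[OF sol t]
    and eq = sd_solution_global(5)[OF sol t]
  define Q where "Q s = real A * C / 2 * (\<Sum>i = A..m. real i powr (k / 2) * \<omega> i s)\<^sup>2" for s
  have rhs: "set_integrable lborel {0..t} (sd_rhs \<Lambda> \<omega> i)" if "1 \<le> i" for i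
  proof (rule sd_rhs_integrable[OF K w c _ I[OF that] that])
    show "AE s\<in>{0..t} in lborel. (\<lambda>j. \<Lambda> i j * \<omega> j s) summable_on {1..}"
      using S by eventually_elim (use that in auto)
  qed
  then have int: "set_integrable lborel {0..t} (\<lambda>s. real (min i A) * sd_rhs \<Lambda> \<omega> i s)" if "1 \<le> i" for i
    using that by (intro set_integrable_mult_right) auto
  have intQ: "set_integrable lborel {0..t} Q"
    unfolding Q_def
    by (intro borel_integrable_atLeastAtMost' continuous_intros c) (use A in auto)
  have "0 \<le> (\<Sum>i = 1..m. real (min i A) * \<omega> i t)"
    using w t by (intro sum_nonneg) auto
  also have "\<dots> = (\<Sum>i = 1..m. real (min i A) * \<omega>in i)
      + (\<Sum>i = 1..m. LINT s:{0..t}|lborel. real (min i A) * sd_rhs \<Lambda> \<omega> i s)"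
    by (simp add: eq algebra_simps sum.distrib)
  also have "(\<Sum>i = 1..m. LINT s:{0..t}|lborel. real (min i A) * sd_rhs \<Lambda> \<omega> i s)
      = (LINT s:{0..t}|lborel. \<Sum>i = 1..m. real (min i A) * sd_rhs \<Lambda> \<omega> i s)"
    using int by (intro set_integral_sum(2)[symmetric]) auto
  also have "\<dots> \<le> (LINT s:{0..t}|lborel. - Q s)"
  proof (rule set_integral_mono_AE)
    show "set_integrable lborel {0..t} (\<lambda>s. \<Sum>i = 1..m. real (min i A) * sd_rhs \<Lambda> \<omega> i s)"
      using int by (intro set_integral_sum(1)) auto
    show "set_integrable lborel {0..t} (\<lambda>s. - Q s)"
      using intQ unfolding set_integrable_def by simp
    show "AE s\<in>{0..t} in lborel. (\<Sum>i = 1..m. real (min i A) * sd_rhs \<Lambda> \<omega> i s) \<le> - Q s"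
      using S
    proof eventually_elim
      case (elim s)
      show ?case
        unfolding Q_def
        by (intro impI sum_min_sd_rhs_le_square K low C A w) (use elim in auto)
    qed
  qed
  also have "\<dots> = - (LINT s:{0..t}|lborel. Q s)"
    by (rule set_integral_uminus[OF intQ])
  finally show ?thesis
    unfolding Q_def by simp
qed

text \<open>
  The bound depends neither on \<open>m\<close> nor on \<open>t\<close>, which is what makes it incompatible with
  conservation of mass.  It is finite since \<open>(k + 1) / 2 > 1\<close>.
\<close>

lemma integral_truncated_moment_square_le:
  assumes K: "coagulation_kernel \<Lambda>"
    and low: "\<And>i j. 1 \<le> i \<Longrightarrow> 1 \<le> j \<Longrightarrow> C * (real i * real j) powr (k / 2) \<le> \<Lambda> i j"
    and C: "0 < C" and k: "1 < k"
    and sol: "sd_solution \<Lambda> \<omega>in \<infinity> \<omega>"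
    and y: "\<omega>in \<in> Y1_plus"
    and t: "0 < t"
  shows "(LINT s:{0..t}|lborel. (\<Sum>i = 1..m. real i * \<omega> i s)\<^sup>2)
    \<le> 2 * (\<Sum>A. real A powr (- ((k + 1) / 2)))\<^sup>2 * (\<Sum>\<^sub>\<infinity>i\<in>{1..}. real i * \<omega>in i) / C"
proof -
  note w = sd_solution_global(1)[OF sol t] and c = sd_solution_global(2)[OF sol t]
  let ?p = "\<lambda>A. real A powr (- ((k + 1) / 2))"
  let ?F = "\<lambda>A s. \<Sum>i = A..m. real i powr (k / 2) * \<omega> i s"
  define M where "M = (\<Sum>\<^sub>\<infinity>i\<in>{1..}. real i * \<omega>in i)"
  have in0: "0 \<le> \<omega>in i" if "1 \<le> i" for i
    using y that unfolding Y1_plus_def by auto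
  have insum: "(\<lambda>i. real i * \<omega>in i) summable_on {1..}"
    using y unfolding Y1_plus_def by auto
  have M0: "0 \<le> M"
    unfolding M_def using in0 by (intro infsum_nonneg) auto
  have F2: "set_integrable lborel {0..t} (\<lambda>s. (?F A s)\<^sup>2)" if "1 \<le> A" for A
    by (intro borel_integrable_atLeastAtMost' continuous_intros c) (use that in auto)
  have int: "set_integrable lborel {0..t} (\<lambda>s. real A powr ((1 - k) / 2) * (?F A s)\<^sup>2)" if "1 \<le> A" for A
    using F2[OF that] by simp
  have mass: "(\<Sum>i = 1..m. real (min i A) * \<omega>in i) \<le> M" for A
  proof -
    have "(\<Sum>i = 1..m. real (min i A) * \<omega>in i) \<le> (\<Sum>i = 1..m. real i * \<omega>in i)"
      using in0 by (intro sum_mono mult_right_mono) auto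
    also have "\<dots> \<le> M"
      unfolding M_def using in0 by (intro finite_sum_le_infsum insum) auto
    finally show ?thesis .
  qed
  have summ: "summable ?p"
    using k by (subst summable_real_powr_iff) auto
  have p_le: "(\<Sum>A = 1..m. ?p A) \<le> suminf ?p"
    using summ by (intro sum_le_suminf) auto
  have "(LINT s:{0..t}|lborel. (\<Sum>i = 1..m. real i * \<omega> i s)\<^sup>2)
      \<le> (LINT s:{0..t}|lborel. (\<Sum>A = 1..m. ?p A) * (\<Sum>A = 1..m. real A powr ((1 - k) / 2) * (?F A s)\<^sup>2))"
  proof (rule set_integral_mono)
    show "set_integrable lborel {0..t} (\<lambda>s. (\<Sum>i = 1..m. real i * \<omega> i s)\<^sup>2)"
      by (auto intro!: borel_integrable_atLeastAtMost' continuous_intros c)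
    show "set_integrable lborel {0..t} (\<lambda>s. (\<Sum>A = 1..m. ?p A) * (\<Sum>A = 1..m. real A powr ((1 - k) / 2) * (?F A s)\<^sup>2))"
      by (auto intro!: borel_integrable_atLeastAtMost' continuous_intros c)
    show "(\<Sum>i = 1..m. real i * \<omega> i s)\<^sup>2
        \<le> (\<Sum>A = 1..m. ?p A) * (\<Sum>A = 1..m. real A powr ((1 - k) / 2) * (?F A s)\<^sup>2)" if "s \<in> {0..t}" for s
      using w that k by (intro first_moment_square_le_tail_squares) auto
  qed
  also have "\<dots> = (\<Sum>A = 1..m. ?p A) * (\<Sum>A = 1..m. real A powr ((1 - k) / 2) * (LINT s:{0..t}|lborel. (?F A s)\<^sup>2))"
  proof -
    have "(LINT s:{0..t}|lborel. \<Sum>A = 1..m. real A powr ((1 - k) / 2) * (?F A s)\<^sup>2)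
        = (\<Sum>A = 1..m. LINT s:{0..t}|lborel. real A powr ((1 - k) / 2) * (?F A s)\<^sup>2)"
      using int by (intro set_integral_sum(2)) auto
    then show ?thesis by simp
  qed
  also have "\<dots> \<le> (\<Sum>A = 1..m. ?p A) * (\<Sum>A = 1..m. 2 * M / C * ?p A)"
  proof (intro mult_left_mono sum_mono sum_nonneg)
    fix A assume A: "A \<in> {1..m}"
    have "real A * C / 2 * (LINT s:{0..t}|lborel. (?F A s)\<^sup>2) \<le> M"
      using A C mass by (intro order_trans[OF integral_tail_square_le[OF K low _ sol t]]) auto
    then have "(LINT s:{0..t}|lborel. (?F A s)\<^sup>2) \<le> 2 * M / C * real A powr (- 1)"
      using A C by (simp add: powr_minus field_simps)
    then have "real A powr ((1 - k) / 2) * (LINT s:{0..t}|lborel. (?F A s)\<^sup>2)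
        \<le> real A powr ((1 - k) / 2) * (2 * M / C * real A powr (- 1))"
      by (intro mult_left_mono) auto
    also have "\<dots> = 2 * M / C * (real A powr ((1 - k) / 2) * real A powr (- 1))"
      by simp
    also have "real A powr ((1 - k) / 2) * real A powr (- 1) = ?p A"
      unfolding powr_add[symmetric] by (rule arg_cong[where f = "(powr) (real A)"]) (simp add: field_simps)
    finally show "real A powr ((1 - k) / 2) * (LINT s:{0..t}|lborel. (?F A s)\<^sup>2) \<le> 2 * M / C * ?p A" .
  qed auto
  also have "\<dots> = 2 * M / C * (\<Sum>A = 1..m. ?p A)\<^sup>2"
    unfolding sum_distrib_left[symmetric] by (simp add: power2_eq_square)
  also have "\<dots> \<le> 2 * M / C * (suminf ?p)\<^sup>2"
    using M0 C p_le by (intro mult_left_mono power_mono) (auto intro!: sum_nonneg)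
  finally show ?thesis
    unfolding M_def by (simp add: mult_ac)
qed

section \<open>Gelation\<close>

text \<open>
  A pointwise lower bound that is only reached at an index depending on the point passes to the
  integrals by monotone convergence.
\<close>

lemma length_mult_le_of_monotone_integrals_le:
  fixes f :: "nat \<Rightarrow> real \<Rightarrow> real"
  assumes t: "0 \<le> t" and c: "0 \<le> c"
    and cont: "\<And>m. continuous_on {0..t} (f m)"
    and nonneg: "\<And>m s. s \<in> {0..t} \<Longrightarrow> 0 \<le> f m s"
    and mono: "\<And>m n s. s \<in> {0..t} \<Longrightarrow> m \<le> n \<Longrightarrow> f m s \<le> f n s"
    and large: "\<And>s. s \<in> {0..t} \<Longrightarrow> \<exists>m. c \<le> f m s"
    and bound: "\<And>m. (LINT s:{0..t}|lborel. f m s) \<le> B" and B: "0 \<le> B"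
  shows "t * c \<le> B"
proof -
  define g where "g m s = ennreal (indicator {0..t} s *\<^sub>R f m s)" for m s
  have intf: "integrable lborel (\<lambda>s. indicator {0..t} s *\<^sub>R f m s)" for m
    using borel_integrable_atLeastAtMost'[OF cont] unfolding set_integrable_def .
  have [measurable]: "g m \<in> borel_measurable lborel" for m
    unfolding g_def using borel_measurable_integrable[OF intf] by measurable
  have "ennreal (t * c) = (\<integral>\<^sup>+s. ennreal c * indicator {0..t} s \<partial>lborel)"
    using t c by (simp add: nn_integral_cmult_indicator ennreal_mult' mult.commute)
  also have "\<dots> \<le> (\<integral>\<^sup>+s. (SUP m. g m s) \<partial>lborel)"
  proof (rule nn_integral_mono)
    fix s
    show "ennreal c * indicator {0..t} s \<le> (SUP m. g m s)"
    proof (cases "s \<in> {0..t}")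
      case True
      then obtain m where "c \<le> f m s" using large by blast
      with True have "ennreal c * indicator {0..t} s \<le> g m s"
        by (simp add: g_def ennreal_leI)
      also have "\<dots> \<le> (SUP m. g m s)" by (rule SUP_upper) simp
      finally show ?thesis .
    qed simp
  qed
  also have "\<dots> = (SUP m. \<integral>\<^sup>+s. g m s \<partial>lborel)"
  proof (rule nn_integral_monotone_convergence_SUP)
    show "incseq g"
      using mono by (auto simp: g_def incseq_def le_fun_def indicator_def intro!: ennreal_leI)
  qed simp
  also have "\<dots> \<le> ennreal B"
  proof (rule SUP_least)
    fix m
    have "(\<integral>\<^sup>+s. g m s \<partial>lborel) = ennreal (LINT s:{0..t}|lborel. f m s)"
      unfolding g_def set_lebesgue_integral_def using nonneg
      by (intro nn_integral_eq_integral intf AE_I2) (auto simp: indicator_def)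
    also have "\<dots> \<le> ennreal B" by (intro ennreal_leI bound)
    finally show "(\<integral>\<^sup>+s. g m s \<partial>lborel) \<le> ennreal B" .
  qed
  finally show ?thesis using B by simp
qed

lemma first_moment_eq_infsum:
  assumes "y \<in> Y1_plus"
  shows "first_moment y = ennreal (\<Sum>\<^sub>\<infinity>i\<in>{1..}. real i * y i)"
proof -
  have y: "0 \<le> y i" if "1 \<le> i" for i
    using assms that unfolding Y1_plus_def by auto
  have s: "(\<lambda>i. real i * y i) summable_on {1..}"
    using assms unfolding Y1_plus_def by auto
  have "ennreal (\<Sum>\<^sub>\<infinity>i\<in>{1..}. real i * y i)
      = (SUP F\<in>{F. finite F \<and> F \<subseteq> {1..}}. ennreal (\<Sum>i\<in>F. real i * y i))"
    using y by (intro infsum_nonneg_is_SUPREMUM_ennreal s) auto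
  also have "\<dots> = (SUP F\<in>{F. finite F \<and> F \<subseteq> {1..}}. \<Sum>i\<in>F. ennreal (real i * y i))"
    using y by (intro SUP_cong refl sum_ennreal[symmetric]) auto
  also have "\<dots> = first_moment y"
    unfolding first_moment_def by (intro nonneg_infsum_complete[symmetric]) simp
  finally show ?thesis by simp
qed

lemma first_moment_less_imp_partial_sum:
  assumes y: "\<And>i. 1 \<le> i \<Longrightarrow> 0 \<le> y i" and c: "ennreal c < first_moment y"
  shows "\<exists>m. c \<le> (\<Sum>i = 1..m. real i * y i)"
proof -
  have "first_moment y = (SUP F\<in>{F. finite F \<and> F \<subseteq> {1..}}. \<Sum>i\<in>F. ennreal (real i * y i))"
    unfolding first_moment_def by (intro nonneg_infsum_complete) simp
  with c obtain F where F: "finite F" "F \<subseteq> {1..}" "ennreal c < (\<Sum>i\<in>F. ennreal (real i * y i))"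
    by (auto simp: less_SUP_iff)
  have "(\<Sum>i\<in>F. ennreal (real i * y i)) = ennreal (\<Sum>i\<in>F. real i * y i)"
    using F y by (intro sum_ennreal) auto
  with F(3) have "ennreal c < ennreal (\<Sum>i\<in>F. real i * y i)"
    by simp
  then have "c \<le> (\<Sum>i\<in>F. real i * y i)"
    by (rule contrapos_pp) (simp add: not_less ennreal_leI)
  also have "\<dots> \<le> (\<Sum>i = 1..Max (insert 0 F). real i * y i)"
    using F y by (intro sum_mono2) auto
  finally show ?thesis by blast
qed

theorem theorem5p1:
  fixes \<Lambda> \<kappa> :: "nat \<Rightarrow> nat \<Rightarrow> real"
    and \<theta> \<omega>in :: "nat \<Rightarrow> real"
    and \<omega> :: "nat \<Rightarrow> real \<Rightarrow> real"
    and C \<kappa>\<^sub>0 :: real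
  assumes "coagulation_kernel \<Lambda>"
    and "\<forall>i\<ge>1. 0 \<le> \<theta> i"
    and "\<forall>i\<ge>1. \<forall>j\<ge>1. 0 \<le> \<kappa> i j"
    and "\<forall>i\<ge>1. \<forall>j\<ge>1. \<Lambda> i j = \<theta> i * \<theta> j + \<kappa> i j"
    and "1 < \<kappa>\<^sub>0" and "\<kappa>\<^sub>0 < 2" and "0 < C"
    and "\<forall>i\<ge>1. \<forall>j\<ge>1. C * (real i * real j) powr (\<kappa>\<^sub>0 / 2) \<le> \<Lambda> i j"
    and "\<omega>in \<in> Y1_plus"
    and "\<exists>i\<ge>1. \<omega>in i \<noteq> 0"
    and "sd_solution \<Lambda> \<omega>in \<infinity> \<omega>"
  shows "gelation_time \<omega>in \<omega> < \<infinity>"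
proof -
  note K = \<open>coagulation_kernel \<Lambda>\<close> and sol = \<open>sd_solution \<Lambda> \<omega>in \<infinity> \<omega>\<close> and y = \<open>\<omega>in \<in> Y1_plus\<close>
  define M where "M = (\<Sum>\<^sub>\<infinity>i\<in>{1..}. real i * \<omega>in i)"
  define B where "B = 2 * (\<Sum>A. real A powr (- ((\<kappa>\<^sub>0 + 1) / 2)))\<^sup>2 * M / C"
  \<comment> \<open>The partial sums of a first moment of at least \<open>M\<close> are only certain to exceed numbers below \<open>M\<close>,
    such as \<open>M / 2\<close>; the summand \<open>1\<close> makes \<open>t * (M / 2)\<^sup>2 > B\<close> strict.\<close>
  define t where "t = B / (M / 2)\<^sup>2 + 1"
  have M: "0 < M"
  proof -
    have y0: "0 \<le> \<omega>in i" if "1 \<le> i" for i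
      using y that unfolding Y1_plus_def by auto
    have s: "(\<lambda>i. real i * \<omega>in i) summable_on {1..}"
      using y unfolding Y1_plus_def by auto
    obtain i where i: "1 \<le> i" "\<omega>in i \<noteq> 0"
      using \<open>\<exists>i\<ge>1. \<omega>in i \<noteq> 0\<close> by blast
    then have "0 < real i * \<omega>in i"
      using y0[of i] by simp
    also have "\<dots> = (\<Sum>i\<in>{i}. real i * \<omega>in i)"
      by simp
    also have "\<dots> \<le> M"
      unfolding M_def using i y0 by (intro finite_sum_le_infsum s) auto
    finally show ?thesis .
  qed
  then have B: "0 \<le> B"
    unfolding B_def using \<open>0 < C\<close> by simp
  then have t: "0 < t"
    unfolding t_def by (simp add: add_nonneg_pos)
  have "\<exists>s\<in>{0..t}. first_moment (\<lambda>i. \<omega> i s) < first_moment \<omega>in"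
  proof (rule ccontr)
    assume "\<not> ?thesis"
    then have no_gel: "first_moment \<omega>in \<le> first_moment (\<lambda>i. \<omega> i s)" if "s \<in> {0..t}" for s
      using that by (meson linorder_not_le)
    note w = sd_solution_global(1)[OF sol t] and c = sd_solution_global(2)[OF sol t]
    have "t * (M / 2)\<^sup>2 \<le> B"
    proof (rule length_mult_le_of_monotone_integrals_le)
      show "continuous_on {0..t} (\<lambda>s. (\<Sum>i = 1..m. real i * \<omega> i s)\<^sup>2)" for m
        by (auto intro!: continuous_intros c)
      show "(\<Sum>i = 1..m. real i * \<omega> i s)\<^sup>2 \<le> (\<Sum>i = 1..n. real i * \<omega> i s)\<^sup>2"
        if "s \<in> {0..t}" "m \<le> n" for m n s
        using that w by (intro power_mono sum_mono2 sum_nonneg) auto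
      show "\<exists>m. (M / 2)\<^sup>2 \<le> (\<Sum>i = 1..m. real i * \<omega> i s)\<^sup>2" if s: "s \<in> {0..t}" for s
      proof -
        have "ennreal (M / 2) < first_moment \<omega>in"
          unfolding first_moment_eq_infsum[OF y] using M by (simp add: M_def ennreal_lessI)
        also have "\<dots> \<le> first_moment (\<lambda>i. \<omega> i s)"
          by (rule no_gel[OF s])
        finally obtain m where "M / 2 \<le> (\<Sum>i = 1..m. real i * \<omega> i s)"
          using first_moment_less_imp_partial_sum[of "\<lambda>i. \<omega> i s"] w s by blast
        then show ?thesis
          using M by (intro exI[of _ m] power_mono) auto
      qed
      show "(LINT s:{0..t}|lborel. (\<Sum>i = 1..m. real i * \<omega> i s)\<^sup>2) \<le> B" for m
        unfolding B_def M_def using assms(8)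
        by (intro integral_truncated_moment_square_le[OF K _ \<open>0 < C\<close> \<open>1 < \<kappa>\<^sub>0\<close> sol y t]) auto
    qed (use t B in auto)
    with M show False
      by (simp add: t_def field_simps)
  qed
  then obtain s where s: "0 \<le> s" "first_moment (\<lambda>i. \<omega> i s) < first_moment \<omega>in"
    by auto
  have "gelation_time \<omega>in \<omega> \<le> ennreal s"
    unfolding gelation_time_def using s by (intro INF_lower) auto
  then show ?thesis
    by (simp add: le_less_trans)
qed

end
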